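(* Let $A,H,B,K$ be logically independent events with $H\neq\emptyset$, $K\neq\emptyset$, and let $P(A|H)=x$, $P(B|K)=y$, $\mathbb{P}[(A|H)\wedge(B|K)]=z$, $\mathbb{P}[(A|H)\vee(B|K)]=\gamma$ be a coherent assessment. Then $\gamma=x+y-z$ and $$\max\{x,y\}\ \le\ \gamma\ \le\ \min\{x+y,1\},$$ that is, $\max\{P(A|H),P(B|K)\}\le \mathbb{P}[(A|H)\vee(B|K)]\le\min\{P(A|H)+P(B|K),1\}$.
   Context: Events are identified with their indicators (value 1 if true, 0 if false); $\emptyset$ is the impossible event, $H^c$ the negation of $H$, juxtaposition denotes conjunction (product of indicators). Four events are logically independent if all $2^4$ conjunctions obtained by taking each event or its negation are different from $\emptyset$. A finite random quantity is a real quantity with finitely many possible values (a finitely-valued real function of the possible outcomes). For an event $H\neq\emptyset$ and a finite random quantity $X$ with assessed conditional prevision $\mathbb{P}(X|H)=\mu\in\mathbb{R}$, the conditional random quantity $X|H$ is the random quantity $X|H = XH+\mu H^c$. For an event $A$ with $P(A|H)=x$ one has $A|H=AH+xH^c$. Conjunction: given $P(A|H)=x$, $P(B|K)=y$, the conjunction is the conditional random quantity $(A|H)\wedge(B|K)=\min\{A|H,B|K\}\,|\,(H\vee K)$, where $A|H=AH+xH^c$ and $B|K=BK+yK^c$. Negation of a conjunction: $[(A|H)\wedge(B|K)]^c=1-(A|H)\wedge(B|K)$. Disjunction: $(A|H)\vee(B|K)=[(A^c|H)\wedge(B^c|K)]^c$, which is the same as the conditional random quantity $\max\{A|H,B|K\}\,|\,(H\vee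 K)$. Coherence: a real function $\mathbb{P}$ on a family $\mathcal{K}$ of finite conditional random quantities is coherent iff for all $n\ge1$, all $X_1|H_1,\dots,X_n|H_n\in\mathcal{K}$ and all real $s_1,\dots,s_n$, setting $\mu_i=\mathbb{P}(X_i|H_i)$ and $\mathcal{G}=\sum_{i=1}^n s_iH_i(X_i-\mu_i)$, the minimum and maximum of the values of $\mathcal{G}$ over the outcomes where $H_1\vee\cdots\vee H_n$ is true satisfy $\min\mathcal{G}\le 0\le\max\mathcal{G}$. *)

theory Defs
  imports Complex_Main "HOL-Library.Indicator_Function"
begin

text \<open>
  The elements of the type \<^typ>\<open>'w\<close> are the possible outcomes. An event is a set of
  outcomes and its indicator is \<^const>\<open>indicator\<close>; a random quantity is a real function
  on the outcomes.
\<close>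

definition logically_independent :: "'w set \<Rightarrow> 'w set \<Rightarrow> 'w set \<Rightarrow> 'w set \<Rightarrow> bool" where
  "logically_independent A H B K \<longleftrightarrow>
     (\<forall>A'\<in>{A, -A}. \<forall>H'\<in>{H, -H}. \<forall>B'\<in>{B, -B}. \<forall>K'\<in>{K, -K}. A' \<inter> H' \<inter> B' \<inter> K' \<noteq> {})"

text \<open>
  A pair \<open>(X, H)\<close> is the bet \<open>X|H\<close> before any assessment. Once a prevision \<open>\<mu>\<close>
  has been assessed for it, it becomes the random quantity \<open>XH + \<mu>H\<^sup>c\<close>.
\<close>

type_synonym 'w cond_rq = "('w \<Rightarrow> real) \<times> 'w set"

definition finite_cond_rq :: "'w cond_rq \<Rightarrow> bool" where
  "finite_cond_rq C \<longleftrightarrow> finite (range (fst C)) \<and> snd C \<noteq> {}"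

definition rq_value :: "'w cond_rq \<Rightarrow> real \<Rightarrow> 'w \<Rightarrow> real" where
  "rq_value C \<mu> w = fst C w * indicator (snd C) w + \<mu> * indicator (- snd C) w"

definition cond_event :: "'w set \<Rightarrow> 'w set \<Rightarrow> 'w cond_rq" where
  "cond_event A H = (indicator A, H)"

text \<open>
  In \<open>cond_conj A H x B K y\<close> the numbers \<open>x\<close> and \<open>y\<close> are the assessed
  probabilities of \<open>A|H\<close> and \<open>B|K\<close>.
\<close>

definition cond_conj ::
  "'w set \<Rightarrow> 'w set \<Rightarrow> real \<Rightarrow> 'w set \<Rightarrow> 'w set \<Rightarrow> real \<Rightarrow> 'w cond_rq" where
  "cond_conj A H x B K y =
     (\<lambda>w. min (rq_value (cond_event A H) x w) (rq_value (cond_event B K) y w), H \<union> K)"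

text \<open>
  The negation \<open>1 - X|H\<close> is again conditional on \<open>H\<close>; its prevision is
  \<open>1 - \<mu>\<close> if \<open>\<mu>\<close> is the one of \<open>X|H\<close> (see \<open>rq_value_cond_neg\<close>). The
  events \<open>A\<^sup>c|H\<close> and \<open>B\<^sup>c|K\<close> in the disjunction therefore have the
  probabilities \<open>1 - x\<close> and \<open>1 - y\<close>.
\<close>

definition cond_neg :: "'w cond_rq \<Rightarrow> 'w cond_rq" where
  "cond_neg C = (\<lambda>w. 1 - fst C w, snd C)"

definition cond_disj ::
  "'w set \<Rightarrow> 'w set \<Rightarrow> real \<Rightarrow> 'w set \<Rightarrow> 'w set \<Rightarrow> real \<Rightarrow> 'w cond_rq" where
  "cond_disj A H x B K y = cond_neg (cond_conj (- A) H (1 - x) (- B) K (1 - y))"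

text \<open>
  The minimum and maximum below range over nonempty finite sets, thanks to the guard
  \<^const>\<open>finite_cond_rq\<close> on the members of the family.
\<close>

definition coherent :: "'w cond_rq set \<Rightarrow> ('w cond_rq \<Rightarrow> real) \<Rightarrow> bool" where
  "coherent F P \<longleftrightarrow>
     (\<forall>C\<in>F. finite_cond_rq C) \<and>
     (\<forall>n\<ge>1. \<forall>C :: nat \<Rightarrow> 'w cond_rq. \<forall>s :: nat \<Rightarrow> real.
        (\<forall>i\<in>{1..n}. C i \<in> F) \<longrightarrow>
        (let G = (\<lambda>w. \<Sum>i=1..n. s i * indicator (snd (C i)) w * (fst (C i) w - P (C i)));
             D = (\<Union>i\<in>{1..n}. snd (C i))
         in Min (G ` D) \<le> 0 \<and> 0 \<le> Max (G ` D)))"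

lemma rq_value_cond_neg: "rq_value (cond_neg C) (1 - \<mu>) w = 1 - rq_value C \<mu> w"
  by (simp add: rq_value_def cond_neg_def indicator_def)

lemma rq_value_cond_event_compl:
  "rq_value (cond_event (- A) H) (1 - x) w = 1 - rq_value (cond_event A H) x w"
  by (simp add: rq_value_def cond_event_def indicator_def)

lemma cond_disj_eq_max:
  "cond_disj A H x B K y =
     (\<lambda>w. max (rq_value (cond_event A H) x w) (rq_value (cond_event B K) y w), H \<union> K)"
  by (auto simp: cond_disj_def cond_neg_def cond_conj_def rq_value_cond_event_compl
      min_def max_def)

text \<open>The finiteness guard in \<^const>\<open>coherent\<close> holds for the quantities of interest.\<close>

lemma finite_cond_rq_cond_event: "H \<noteq> {} \<Longrightarrow> finite_cond_rq (cond_event A H)"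
proof -
  assume "H \<noteq> {}"
  moreover have "range (indicator A :: 'a \<Rightarrow> real) \<subseteq> {0, 1}"
    by (auto simp: indicator_def)
  ultimately show ?thesis
    by (auto simp: finite_cond_rq_def cond_event_def intro: finite_subset)
qed

lemma rq_value_cond_event_cases: "rq_value (cond_event A H) x w \<in> {0, 1, x}"
  by (auto simp: rq_value_def cond_event_def indicator_def)

lemma finite_cond_rq_cond_conj:
  assumes "H \<noteq> {}"
  shows "finite_cond_rq (cond_conj A H x B K y)"
proof -
  have "min (rq_value (cond_event A H) x w) (rq_value (cond_event B K) y w) \<in> {0, 1, x, y}" for w
    using rq_value_cond_event_cases[of A H x w] rq_value_cond_event_cases[of B K y w]
    by (auto simp: min_def)
  then have "range (fst (cond_conj A H x B K y)) \<subseteq> {0, 1, x, y}"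
    by (auto simp: cond_conj_def)
  then show ?thesis
    using assms by (auto simp: finite_cond_rq_def cond_conj_def intro: finite_subset)
qed

lemma finite_cond_rq_cond_disj:
  assumes "H \<noteq> {}"
  shows "finite_cond_rq (cond_disj A H x B K y)"
proof -
  have "finite_cond_rq (cond_neg C)" if "finite_cond_rq C" for C :: "'a cond_rq"
  proof -
    have "range (fst (cond_neg C)) = (\<lambda>r. 1 - r) ` range (fst C)"
      by (auto simp: cond_neg_def)
    then show ?thesis
      using that by (simp add: finite_cond_rq_def) (simp add: cond_neg_def)
  qed
  then show ?thesis
    by (simp add: cond_disj_def finite_cond_rq_cond_conj assms)
qed

end

theory Submission
  imports Defs "HOL-Library.FuncSet"
begin

text \<open>
  Write \<open>a = A|H\<close> and \<open>b = B|K\<close> for the two conditional events as random quantities. Since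
  \<open>H (X - \<mu>) = X|H - \<mu>\<close>, a bet on \<open>X|H\<close> pays off the value of \<open>X|H\<close> minus its prevision,
  even where it is called off. Coherence then says that a linear combination of bets that pays
  at least \<open>c\<close>, as soon as one of them is not called off, has \<open>c \<le> 0\<close>
  (\<open>coherent_guaranteed_gain\<close>). On \<open>H \<or> K\<close> the conjunction and the disjunction have the
  values \<open>min a b\<close> and \<open>max a b\<close>, so every part of the theorem comes from one elementary
  relation between these numbers:

  \<^item> \<open>min a b + max a b = a + b\<close> gives \<open>z + \<gamma> = x + y\<close>: the corresponding combination
    of bets is constant on \<open>H \<or> K\<close>, and it can be taken with either sign.

  \<^item> \<open>a \<le> max a b\<close> gives \<open>x \<le> \<gamma>\<close>, and likewise for \<open>y\<close>.

  \<^item> \<open>max a b \<le> a + b\<close> and \<open>max a b \<le> 1\<close> give the upper bounds. These relations hold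
    because \<open>a\<close> and \<open>b\<close> lie in \<open>[0, 1]\<close>; where the bets are called off this is the
    fact that a coherent probability lies in \<open>[0, 1]\<close>.
\<close>

lemma rq_value_minus_prevision:
  "rq_value C \<mu> w - \<mu> = indicator (snd C) w * (fst C w - \<mu>)"
  by (simp add: rq_value_def indicator_def)

text \<open>
  The bets are given as a list rather than as a function on the family because two members of
  the family could be the same pair, and the stakes on them would then have to be added up.
\<close>

lemma coherent_guaranteed_gain:
  fixes P :: "'w cond_rq \<Rightarrow> real" and bets :: "(real \<times> 'w cond_rq) list"
  assumes coh: "coherent F P"
    and bets: "bets \<noteq> []" "snd ` set bets \<subseteq> F"
    and gain: "\<And>w. w \<in> (\<Union>(s, C)\<in>set bets. snd C) \<Longrightarrow>
                 c \<le> (\<Sum>(s, C)\<leftarrow>bets. s * (rq_value C (P C) w - P C))"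
  shows "c \<le> 0"
proof -
  define n where "n = length bets"
  define s where "s i = fst (bets ! (i - 1))" for i
  define C where "C i = snd (bets ! (i - 1))" for i
  define D where "D = (\<Union>i\<in>{1..n}. snd (C i))"
  define G where "G w = (\<Sum>i=1..n. s i * indicator (snd (C i)) w * (fst (C i) w - P (C i)))" for w
  have n: "n \<ge> 1"
    using bets(1) by (cases bets) (simp_all add: n_def)
  have CF: "C i \<in> F" if "i \<in> {1..n}" for i
  proof -
    have "bets ! (i - 1) \<in> set bets"
      using that by (intro nth_mem) (auto simp: n_def)
    then show ?thesis
      using bets(2) by (auto simp: C_def)
  qed
  have fin: "finite_cond_rq (C i)" if "i \<in> {1..n}" for i
    using coh CF[OF that] by (simp add: coherent_def)
  have "Min (G ` D) \<le> 0"
    using coh n CF unfolding coherent_def Let_def G_def D_def by blast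

  \<comment> \<open>The minimum is a value of \<open>G\<close> only because \<open>G ` D\<close> is finite and nonempty. It is
    finite because \<open>G\<close> factors through the joint values \<open>R\<close> of the bets.\<close>
  moreover have "finite (G ` D)"
  proof -
    define R where "R = (\<Pi>\<^sub>E i\<in>{1..n}. {0, 1 :: real} \<times> range (fst (C i)))"
    define g :: "(nat \<Rightarrow> real \<times> real) \<Rightarrow> real"
      where "g r = (\<Sum>i=1..n. s i * fst (r i) * (snd (r i) - P (C i)))" for r
    have "finite R"
      unfolding R_def using fin by (intro finite_PiE) (auto simp: finite_cond_rq_def)
    moreover have "G w \<in> g ` R" for w
    proof
      let ?r = "\<lambda>i\<in>{1..n}. (indicator (snd (C i)) w :: real, fst (C i) w)"
      show "G w = g ?r"
        by (simp add: G_def g_def)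
      show "?r \<in> R"
        by (auto simp: R_def indicator_def)
    qed
    ultimately show ?thesis
      by (meson finite_imageI finite_subset image_subsetI)
  qed
  moreover have "D \<noteq> {}"
  proof -
    have "snd (C 1) \<noteq> {}" "1 \<in> {1..n}"
      using fin[of 1] n by (auto simp: finite_cond_rq_def)
    then show ?thesis
      unfolding D_def by blast
  qed
  ultimately have "\<exists>w\<in>D. G w \<le> 0"
    by (simp add: Min_le_iff)
  then obtain w where w: "w \<in> D" "G w \<le> 0"
    by blast

  have "G w = (\<Sum>i=1..n. s i * (rq_value (C i) (P (C i)) w - P (C i)))"
    by (simp add: G_def rq_value_minus_prevision mult.assoc)
  also have "\<dots> = (\<Sum>i<n. s (Suc i) * (rq_value (C (Suc i)) (P (C (Suc i))) w - P (C (Suc i))))"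
    by (simp only: One_nat_def sum.atLeast_Suc_atMost_Suc_shift sum.atLeast1_atMost_eq)
  also have "\<dots> = (\<Sum>(s, C)\<leftarrow>bets. s * (rq_value C (P C) w - P C))"
    by (simp add: sum_list_sum_nth n_def s_def C_def case_prod_unfold atLeast0LessThan)
  finally have G: "G w = (\<Sum>(s, C)\<leftarrow>bets. s * (rq_value C (P C) w - P C))" .

  obtain i where "i \<in> {1..n}" "w \<in> snd (C i)"
    using w(1) by (auto simp: D_def)
  then have "bets ! (i - 1) \<in> set bets" "w \<in> snd (snd (bets ! (i - 1)))"
    by (auto simp: n_def C_def intro!: nth_mem)
  then have "w \<in> (\<Union>(s, C)\<in>set bets. snd C)"
    by (auto simp: case_prod_unfold)
  from gain[OF this] G w(2) show ?thesis
    by simp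
qed

lemma coherent_cond_event_bounds:
  assumes coh: "coherent F P" and mem: "cond_event A H \<in> F"
  shows "0 \<le> P (cond_event A H)" and "P (cond_event A H) \<le> 1"
proof -
  let ?E = "cond_event A H"
  have val: "0 \<le> rq_value ?E (P ?E) w \<and> rq_value ?E (P ?E) w \<le> 1" if "w \<in> H" for w
    using that by (simp add: rq_value_def cond_event_def indicator_def)
  have "- P ?E \<le> 0"
    by (rule coherent_guaranteed_gain[OF coh, of "[(1, ?E)]"])
       (use mem val in \<open>auto simp: cond_event_def\<close>)
  then show "0 \<le> P ?E"
    by simp
  have "P ?E - 1 \<le> 0"
    by (rule coherent_guaranteed_gain[OF coh, of "[(-1, ?E)]"])
       (use mem val in \<open>auto simp: cond_event_def\<close>)
  then show "P ?E \<le> 1"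
    by simp
qed

theorem mainTheorem11:
  fixes A H B K :: "'w set" and P :: "'w cond_rq \<Rightarrow> real" and x y z \<gamma> :: real
  assumes "logically_independent A H B K"
    and "H \<noteq> {}" and "K \<noteq> {}"
    and "coherent {cond_event A H, cond_event B K,
                   cond_conj A H x B K y, cond_disj A H x B K y} P"
    and "P (cond_event A H) = x"
    and "P (cond_event B K) = y"
    and "P (cond_conj A H x B K y) = z"
    and "P (cond_disj A H x B K y) = \<gamma>"
  shows "\<gamma> = x + y - z \<and> max x y \<le> \<gamma> \<and> \<gamma> \<le> min (x + y) 1"
proof -
  let ?E = "cond_event A H" and ?F = "cond_event B K"
  let ?C = "cond_conj A H x B K y" and ?D = "cond_disj A H x B K y"
  note gain = coherent_guaranteed_gain[OF assms(4)]
  note P = assms(5-8)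
  define a where "a w = rq_value ?E x w" for w
  define b where "b w = rq_value ?F y w" for w
  have conj: "rq_value ?C z w = min (a w) (b w)" if "w \<in> H \<union> K" for w
    using that by (simp add: rq_value_def[of ?C] a_def b_def) (simp add: cond_conj_def)
  have disj: "rq_value ?D \<gamma> w = max (a w) (b w)" if "w \<in> H \<union> K" for w
    using that by (simp add: rq_value_def[of ?D] a_def b_def) (simp add: cond_disj_eq_max)
  have conditions: "snd ?E = H" "snd ?F = K" "snd ?C = H \<union> K" "snd ?D = H \<union> K"
    by (simp_all add: cond_event_def cond_conj_def cond_disj_eq_max)
  note eval = P conditions a_def[symmetric] b_def[symmetric] conj disj

  have "0 \<le> x" "x \<le> 1" "0 \<le> y" "y \<le> 1"
    using coherent_cond_event_bounds[OF assms(4), of A H]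
      coherent_cond_event_bounds[OF assms(4), of B K] P by simp_all
  then have unit: "0 \<le> a w" "a w \<le> 1" "0 \<le> b w" "b w \<le> 1" for w
    using rq_value_cond_event_cases[of A H x w] rq_value_cond_event_cases[of B K y w]
    by (auto simp: a_def b_def)

  have "z + \<gamma> - x - y \<le> 0"
    by (rule gain[of "[(1, ?E), (1, ?F), (-1, ?C), (-1, ?D)]"])
       (auto simp: eval min_def max_def)
  moreover have "x + y - z - \<gamma> \<le> 0"
    by (rule gain[of "[(-1, ?E), (-1, ?F), (1, ?C), (1, ?D)]"])
       (auto simp: eval min_def max_def)
  moreover have "x - \<gamma> \<le> 0"
    by (rule gain[of "[(1, ?D), (-1, ?E)]"]) (auto simp: eval)
  moreover have "y - \<gamma> \<le> 0"
    by (rule gain[of "[(1, ?D), (-1, ?F)]"]) (auto simp: eval)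
  moreover have "\<gamma> - x - y \<le> 0"
    by (rule gain[of "[(1, ?E), (1, ?F), (-1, ?D)]"])
       (use unit in \<open>auto simp: eval max_def\<close>)
  moreover have "\<gamma> - 1 \<le> 0"
    by (rule gain[of "[(-1, ?D)]"]) (use unit in \<open>auto simp: eval\<close>)
  ultimately show ?thesis
    by simp
qed

end
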